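(* Let $(A, \cdot_A, \omega)$ be a Bernstein algebra (respectively, a normal Bernstein algebra) and let $N := \mathrm{Ker}(\omega)$. Then there exist a $4$-algebra structure $\cdot$ on $N$, a Bernstein operator (respectively, a normal Bernstein operator) $\Omega$ on $(N, \cdot)$, and an isomorphism of Bernstein algebras $\psi : N \ltimes_{(\cdot,\,\Omega)} k \to A$ that stabilizes $N$, i.e. $\psi(x, 0) = x$ for all $x \in N$.
   Context: Throughout, $k$ is an infinite field of characteristic $\neq 2$; all vector spaces and (bi)linear maps are over $k$ (vector spaces may be infinite dimensional). An algebra is a vector space $A$ with a bilinear multiplication $A \times A \to A$ (no associativity or unit assumed); $a^2$ denotes the product of $a$ with itself. A baric algebra is a pair $(A, \omega)$ consisting of a commutative algebra $A$ and a non-zero algebra morphism $\omega : A \to k$, called the weight. A Bernstein algebra is a baric algebra $(A, \omega)$ such that $(a^2)^2 = \omega(a)^2\, a^2$ for all $a \in A$. A normal Bernstein algebra is a baric algebra $(A, \omega)$ such that $a^2 \cdot b = \omega(a)\, a \cdot b$ for all $a, b \in A$; every normal Bernstein algebra is a Bernstein algebra. A morphism of Bernstein algebras $(A, \omega_A) \to (B, \omega_B)$ is an algebra map $\psi : A \to B$ with $\omega_B \circ \psi = \omega_A$; an isomorphism is a bijective morphism. A $4$-algebra is a commutative algebra $(N, \cdot)$ such that $(x^2)^2 = 0$ for all $x \in N$. A Bernstein operator on a $4$-algebra $(N, \cdot)$ is an idempotent $\Omega = \Omega^2 \in \mathrm{End}_k(N)$ such that $x^2 \cdot \Omega(x) =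 0$ and $\Omega(x)^2 + \Omega(x^2) = x^2$ for all $x \in N$ (here $\Omega(x)^2 = \Omega(x) \cdot \Omega(x)$). A normal Bernstein operator on a $4$-algebra $(N, \cdot)$ is an idempotent $\Omega = \Omega^2 \in \mathrm{End}_k(N)$ such that $\Omega(x^2) = 0$ and $\Omega(x) \cdot y = x \cdot y$ for all $x, y \in N$; every normal Bernstein operator is a Bernstein operator. For a $4$-algebra $(N, \cdot)$ and a Bernstein operator $\Omega$ on it, the semidirect product $N \ltimes_{(\cdot,\,\Omega)} k$ is the Bernstein algebra with underlying vector space $N \times k$, multiplication $$(x, \alpha) \circ (y, \beta) := \bigl(x \cdot y + \tfrac{1}{2}\alpha\, \Omega(y) + \tfrac{1}{2}\beta\, \Omega(x),\ \alpha\beta\bigr)$$ and weight $\pi_2(x, \alpha) = \alpha$. *)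

theory Defs
  imports "HOL-Analysis.Product_Vector" "HOL-Library.FuncSet"
begin

text \<open>
  Kernels of weights are not types of their own, so every vector space here is a subspace \<open>V\<close> of an
  ambient vector space given by \<^locale>\<open>vector_space\<close>; for \<open>V = UNIV\<close> it is the whole type.
  All operations and maps are constrained on the carrier only.
\<close>

definition linear_on ::
  "('k::field \<Rightarrow> 'a::ab_group_add \<Rightarrow> 'a) \<Rightarrow> 'a set \<Rightarrow>
   ('k \<Rightarrow> 'b::ab_group_add \<Rightarrow> 'b) \<Rightarrow> 'b set \<Rightarrow> ('a \<Rightarrow> 'b) \<Rightarrow> bool" where
  "linear_on s V t W f \<longleftrightarrow>
     f \<in> V \<rightarrow> W \<and>
     (\<forall>x\<in>V. \<forall>y\<in>V. f (x + y) = f x + f y) \<and>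
     (\<forall>c. \<forall>x\<in>V. f (s c x) = t c (f x))"

locale nonassoc_algebra = vector_space scale
  for scale :: "'k::field \<Rightarrow> 'a::ab_group_add \<Rightarrow> 'a" (infixr \<open>\<odot>\<close> 75) +
  fixes A :: "'a set" and mult :: "'a \<Rightarrow> 'a \<Rightarrow> 'a" (infixl \<open>\<bullet>\<^sub>A\<close> 70)
  assumes carrier_subspace: "subspace A"
    and mult_closed: "x \<in> A \<Longrightarrow> y \<in> A \<Longrightarrow> x \<bullet>\<^sub>A y \<in> A"
    and mult_add_left: "x \<in> A \<Longrightarrow> y \<in> A \<Longrightarrow> z \<in> A \<Longrightarrow> (x + y) \<bullet>\<^sub>A z = x \<bullet>\<^sub>A z + y \<bullet>\<^sub>A z"
    and mult_add_right: "x \<in> A \<Longrightarrow> y \<in> A \<Longrightarrow> z \<in> A \<Longrightarrow> x \<bullet>\<^sub>A (y + z) = x \<bullet>\<^sub>A y + x \<bullet>\<^sub>A z"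
    and mult_scale_left: "x \<in> A \<Longrightarrow> y \<in> A \<Longrightarrow> (c \<odot> x) \<bullet>\<^sub>A y = c \<odot> (x \<bullet>\<^sub>A y)"
    and mult_scale_right: "x \<in> A \<Longrightarrow> y \<in> A \<Longrightarrow> x \<bullet>\<^sub>A (c \<odot> y) = c \<odot> (x \<bullet>\<^sub>A y)"

locale comm_nonassoc_algebra = nonassoc_algebra +
  assumes mult_comm: "x \<in> A \<Longrightarrow> y \<in> A \<Longrightarrow> x \<bullet>\<^sub>A y = y \<bullet>\<^sub>A x"

definition algebra_morphism ::
  "('k::field \<Rightarrow> 'a::ab_group_add \<Rightarrow> 'a) \<Rightarrow> 'a set \<Rightarrow> ('a \<Rightarrow> 'a \<Rightarrow> 'a) \<Rightarrow>
   ('k \<Rightarrow> 'b::ab_group_add \<Rightarrow> 'b) \<Rightarrow> 'b set \<Rightarrow> ('b \<Rightarrow> 'b \<Rightarrow> 'b) \<Rightarrow> ('a \<Rightarrow> 'b) \<Rightarrow> bool" where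
  "algebra_morphism s A m t B n f \<longleftrightarrow>
     nonassoc_algebra s A m \<and> nonassoc_algebra t B n \<and>
     linear_on s A t B f \<and>
     (\<forall>x\<in>A. \<forall>y\<in>A. f (m x y) = n (f x) (f y))"

lemma comm_nonassoc_algebra_field:
  "comm_nonassoc_algebra ((*) :: 'k::field \<Rightarrow> 'k \<Rightarrow> 'k) UNIV (*)"
proof -
  have vs: "vector_space ((*) :: 'k \<Rightarrow> 'k \<Rightarrow> 'k)"
    by unfold_locales (simp_all add: distrib_left distrib_right)
  then have "module ((*) :: 'k \<Rightarrow> 'k \<Rightarrow> 'k)"
    by (simp only: module_iff_vector_space)
  then have "module.subspace ((*) :: 'k \<Rightarrow> 'k \<Rightarrow> 'k) UNIV"
    by (rule module.subspace_UNIV)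
  with vs show ?thesis
    by (simp add: comm_nonassoc_algebra_def nonassoc_algebra_def nonassoc_algebra_axioms_def
        comm_nonassoc_algebra_axioms_def distrib_left distrib_right mult.commute mult.left_commute)
qed

locale baric_algebra = comm_nonassoc_algebra +
  fixes \<omega> :: "'b \<Rightarrow> 'a"
  assumes weight_morphism: "algebra_morphism scale A mult (*) UNIV (*) \<omega>"
    and weight_nonzero: "\<exists>x\<in>A. \<omega> x \<noteq> 0"

locale bernstein_algebra = baric_algebra +
  assumes bernstein: "x \<in> A \<Longrightarrow> (x \<bullet>\<^sub>A x) \<bullet>\<^sub>A (x \<bullet>\<^sub>A x) = (\<omega> x)\<^sup>2 \<odot> (x \<bullet>\<^sub>A x)"

locale normal_bernstein_algebra = baric_algebra +
  assumes normal_bernstein: "x \<in> A \<Longrightarrow> y \<in> A \<Longrightarrow> (x \<bullet>\<^sub>A x) \<bullet>\<^sub>A y = \<omega> x \<odot> (x \<bullet>\<^sub>A y)"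

sublocale normal_bernstein_algebra \<subseteq> bernstein_algebra
proof
  fix x assume x: "x \<in> A"
  then have xx: "x \<bullet>\<^sub>A x \<in> A"
    by (intro mult_closed)
  have "(x \<bullet>\<^sub>A x) \<bullet>\<^sub>A (x \<bullet>\<^sub>A x) = \<omega> x \<odot> (x \<bullet>\<^sub>A (x \<bullet>\<^sub>A x))"
    by (rule normal_bernstein[OF x xx])
  also have "x \<bullet>\<^sub>A (x \<bullet>\<^sub>A x) = (x \<bullet>\<^sub>A x) \<bullet>\<^sub>A x"
    by (rule mult_comm[OF x xx])
  also have "\<dots> = \<omega> x \<odot> (x \<bullet>\<^sub>A x)"
    by (rule normal_bernstein[OF x x])
  also have "\<omega> x \<odot> \<dots> = (\<omega> x)\<^sup>2 \<odot> (x \<bullet>\<^sub>A x)"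
    by (simp only: power2_eq_square scale_scale)
  finally show "(x \<bullet>\<^sub>A x) \<bullet>\<^sub>A (x \<bullet>\<^sub>A x) = (\<omega> x)\<^sup>2 \<odot> (x \<bullet>\<^sub>A x)" .
qed

definition bernstein_morphism ::
  "('k::field \<Rightarrow> 'a::ab_group_add \<Rightarrow> 'a) \<Rightarrow> 'a set \<Rightarrow> ('a \<Rightarrow> 'a \<Rightarrow> 'a) \<Rightarrow> ('a \<Rightarrow> 'k) \<Rightarrow>
   ('k \<Rightarrow> 'b::ab_group_add \<Rightarrow> 'b) \<Rightarrow> 'b set \<Rightarrow> ('b \<Rightarrow> 'b \<Rightarrow> 'b) \<Rightarrow> ('b \<Rightarrow> 'k) \<Rightarrow> ('a \<Rightarrow> 'b) \<Rightarrow> bool" where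
  "bernstein_morphism s A m \<omega>A t B n \<omega>B \<psi> \<longleftrightarrow>
     bernstein_algebra s A m \<omega>A \<and> bernstein_algebra t B n \<omega>B \<and>
     algebra_morphism s A m t B n \<psi> \<and>
     (\<forall>x\<in>A. \<omega>B (\<psi> x) = \<omega>A x)"

definition bernstein_isomorphism ::
  "('k::field \<Rightarrow> 'a::ab_group_add \<Rightarrow> 'a) \<Rightarrow> 'a set \<Rightarrow> ('a \<Rightarrow> 'a \<Rightarrow> 'a) \<Rightarrow> ('a \<Rightarrow> 'k) \<Rightarrow>
   ('k \<Rightarrow> 'b::ab_group_add \<Rightarrow> 'b) \<Rightarrow> 'b set \<Rightarrow> ('b \<Rightarrow> 'b \<Rightarrow> 'b) \<Rightarrow> ('b \<Rightarrow> 'k) \<Rightarrow> ('a \<Rightarrow> 'b) \<Rightarrow> bool" where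
  "bernstein_isomorphism s A m \<omega>A t B n \<omega>B \<psi> \<longleftrightarrow>
     bernstein_morphism s A m \<omega>A t B n \<omega>B \<psi> \<and> bij_betw \<psi> A B"

definition weight_kernel :: "'a set \<Rightarrow> ('a \<Rightarrow> 'k::zero) \<Rightarrow> 'a set" where
  "weight_kernel A \<omega> = {x \<in> A. \<omega> x = 0}"

locale four_algebra = comm_nonassoc_algebra scale N mult
  for scale :: "'k::field \<Rightarrow> 'a::ab_group_add \<Rightarrow> 'a" (infixr \<open>\<odot>\<close> 75)
    and N :: "'a set" and mult :: "'a \<Rightarrow> 'a \<Rightarrow> 'a" (infixl \<open>\<cdot>\<close> 70) +
  assumes square_square: "x \<in> N \<Longrightarrow> (x \<cdot> x) \<cdot> (x \<cdot> x) = 0"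

locale bernstein_operator = four_algebra +
  fixes \<Omega> :: "'b \<Rightarrow> 'b"
  assumes operator_linear: "linear_on scale N scale N \<Omega>"
    and operator_idem: "x \<in> N \<Longrightarrow> \<Omega> (\<Omega> x) = \<Omega> x"
    and square_mult_operator: "x \<in> N \<Longrightarrow> (x \<cdot> x) \<cdot> \<Omega> x = 0"
    and operator_square: "x \<in> N \<Longrightarrow> \<Omega> x \<cdot> \<Omega> x + \<Omega> (x \<cdot> x) = x \<cdot> x"

locale normal_bernstein_operator = four_algebra +
  fixes \<Omega> :: "'b \<Rightarrow> 'b"
  assumes normal_operator_linear: "linear_on scale N scale N \<Omega>"
    and normal_operator_idem: "x \<in> N \<Longrightarrow> \<Omega> (\<Omega> x) = \<Omega> x"
    and normal_operator_square: "x \<in> N \<Longrightarrow> \<Omega> (x \<cdot> x) = 0"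
    and normal_operator_mult: "x \<in> N \<Longrightarrow> y \<in> N \<Longrightarrow> \<Omega> x \<cdot> y = x \<cdot> y"

sublocale normal_bernstein_operator \<subseteq> bernstein_operator
proof
  show "linear_on scale N scale N \<Omega>"
    by (fact normal_operator_linear)
  fix x assume x: "x \<in> N"
  then have Ox: "\<Omega> x \<in> N"
    using normal_operator_linear by (auto simp: linear_on_def)
  show "\<Omega> (\<Omega> x) = \<Omega> x"
    using x by (fact normal_operator_idem)
  have xx: "x \<cdot> x \<in> N"
    using x x by (rule mult_closed)
  have "\<Omega> x \<cdot> \<Omega> x = x \<cdot> x"
    using normal_operator_mult[OF x Ox] mult_comm[OF x Ox] normal_operator_mult[OF x x]
    by (simp only:)
  then show "\<Omega> x \<cdot> \<Omega> x + \<Omega> (x \<cdot> x) = x \<cdot> x"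
    by (simp only: normal_operator_square[OF x] add_0_right)
  have "(x \<cdot> x) \<cdot> \<Omega> x = 0 \<cdot> \<Omega> x"
    using normal_operator_mult[OF xx Ox] by (simp only: normal_operator_square[OF x])
  also have "\<dots> = 0"
    using mult_scale_left[OF x Ox, of 0] by (simp only: scale_zero_left)
  finally show "(x \<cdot> x) \<cdot> \<Omega> x = 0" .
qed

text \<open>
  The semidirect product has carrier \<open>N \<times> UNIV\<close>, scalar multiplication
  \<open>module_prod.scale s (*)\<close> (componentwise, for
  \<open>s\<close> the one of \<open>N\<close>), weight \<open>snd\<close> and the following multiplication.
\<close>

definition semidirect_mult ::
  "('k::field \<Rightarrow> 'a::ab_group_add \<Rightarrow> 'a) \<Rightarrow> ('a \<Rightarrow> 'a \<Rightarrow> 'a) \<Rightarrow> ('a \<Rightarrow> 'a) \<Rightarrow>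
   'a \<times> 'k \<Rightarrow> 'a \<times> 'k \<Rightarrow> 'a \<times> 'k" where
  "semidirect_mult s m \<Omega> =
     (\<lambda>(x, \<alpha>) (y, \<beta>).
        (m x y + s (1 / 2 * \<alpha>) (\<Omega> y) + s (1 / 2 * \<beta>) (\<Omega> x), \<alpha> * \<beta>))"

end

theory Submission
  imports Defs
begin

text \<open>
  If \<open>a\<close> has weight 1, the Bernstein identity makes \<open>e = a\<^sup>2\<close> an idempotent, again of weight 1,
  so that \<open>A\<close> is the direct sum of \<open>N = Ker \<omega>\<close> and the line through \<open>e\<close>. The product of \<open>N\<close> is the
  one of \<open>A\<close>, the operator is \<open>\<Omega> x = 2 e x\<close>, and \<open>\<psi> (x, \<alpha>) = x + \<alpha> e\<close>; the factor 2 cancels the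
  two halves in the semidirect product.

  That \<open>\<Omega>\<close> is a Bernstein operator comes from expanding the Bernstein identity at \<open>x + \<alpha> e\<close> for
  \<open>x \<in> N\<close>. Because \<open>(x + \<alpha> e)\<^sup>2 = x\<^sup>2 + \<alpha> \<Omega> x + \<alpha>\<^sup>2 e\<close>, the result is a polynomial identity in \<open>\<alpha>\<close>
  whose coefficients at \<open>\<alpha>\<close>, \<open>\<alpha>\<^sup>2\<close> and \<open>\<alpha>\<^sup>3\<close> are the three axioms. Over an infinite field of
  characteristic not 2 each coefficient vanishes (\<open>vector_cubic_vanishes\<close>). The normal
  identity \<open>a\<^sup>2 b = \<omega> a \<cdot> a b\<close> yields \<open>\<Omega> (x\<^sup>2) = 0\<close> at \<open>a = x\<close>, \<open>b = e\<close>, and \<open>\<Omega> x \<cdot> y = x y\<close> at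
  \<open>a = x + e\<close>, \<open>b = y\<close>.

  The axioms of the semidirect product are identities that \<open>\<psi>\<close>, being linear, multiplicative and
  injective, pulls back from \<open>A\<close> (\<open>bernstein_algebra_pullback\<close>).
\<close>

section \<open>Vector polynomials and pulled-back algebras\<close>

lemma two_neq_zero_if_CHAR_neq_2:
  assumes "CHAR('k::field) \<noteq> 2"
  shows "(2::'k) \<noteq> 0"
proof
  assume "(2::'k) = 0"
  then have "of_nat 2 = (0::'k)" by simp
  then have "CHAR('k) dvd 2" by (simp only: of_nat_eq_0_iff_char_dvd)
  moreover from this have "CHAR('k) \<noteq> 0" by (metis dvd_0_left_iff zero_neq_numeral)
  moreover from \<open>CHAR('k) dvd 2\<close> have "CHAR('k) \<le> 2" by (rule dvd_imp_le) simp
  ultimately have "CHAR('k) = 1 \<or> CHAR('k) = 2" by linarith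
  with assms show False by simp
qed

text \<open>
  The values at \<open>1\<close> and \<open>-1\<close> separate the even coefficient \<open>v\<close> from the odd ones, and any scalar
  whose cube differs from itself separates \<open>u\<close> from \<open>w\<close>.
\<close>

lemma (in vector_space) vector_cubic_vanishes:
  assumes inf: "infinite (UNIV :: 'a set)" and two: "(2::'a) \<noteq> 0"
    and zero: "\<And>a. scale a u + scale (a\<^sup>2) v + scale (a ^ 3) w = 0"
  shows "u = 0" "v = 0" "w = 0"
proof -
  have p: "u + v + w = 0" using zero[of 1] by simp
  have m: "v = u + w" using zero[of "-1"] by (simp add: algebra_simps)
  have "scale 2 v = 0"
    using p m scale_left_distrib[of 1 1 v] by (simp add: algebra_simps)
  with two show v: "v = 0" by simp
  with m have u: "u = - w" by (simp add: eq_neg_iff_add_eq_0)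
  have "\<exists>a::'a. a \<notin> {0, 1, -1}"
    using inf by (intro ex_new_if_finite) auto
  then obtain a :: 'a where a: "a \<noteq> 0" "a \<noteq> 1" "a \<noteq> -1" by auto
  have "scale (a ^ 3 - a) w = 0"
    using zero[of a] u v by (simp add: scale_left_diff_distrib)
  moreover have "a ^ 3 - a = a * ((a - 1) * (a + 1))"
    by (simp add: algebra_simps power3_eq_cube)
  then have "a ^ 3 - a \<noteq> 0" using a by (simp add: add_eq_0_iff2)
  ultimately show "w = 0" by simp
  with u show "u = 0" by simp
qed

text \<open>
  Injectivity of \<open>f\<close> on the carrier turns every polynomial identity of \<open>A\<close> into one of \<open>B\<close>. This
  spares checking bilinearity and the Bernstein identity on coordinates of the semidirect product.
\<close>

lemma (in bernstein_algebra) bernstein_algebra_pullback: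
  assumes vs: "vector_space t" and sub: "module.subspace t B"
    and lin: "linear_on t B scale A f" and inj: "inj_on f B"
    and closed: "\<And>x y. x \<in> B \<Longrightarrow> y \<in> B \<Longrightarrow> n x y \<in> B"
    and hom: "\<And>x y. x \<in> B \<Longrightarrow> y \<in> B \<Longrightarrow> f (n x y) = mult (f x) (f y)"
    and weight: "\<And>x. x \<in> B \<Longrightarrow> v x = \<omega> (f x)"
    and nonzero: "\<exists>x\<in>B. v x \<noteq> 0"
  shows "bernstein_algebra t B n v"
proof -
  interpret B: vector_space t by (rule vs)
  note cl = closed B.subspace_add[OF sub] B.subspace_scale[OF sub]
  have fA: "f x \<in> A" if "x \<in> B" for x
    using lin that by (auto simp: linear_on_def)
  have f_add: "f (x + y) = f x + f y" if "x \<in> B" "y \<in> B" for x y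
    using lin that by (auto simp: linear_on_def)
  have f_scale: "f (t c x) = scale c (f x)" if "x \<in> B" for c x
    using lin that by (auto simp: linear_on_def)
  have eqI: "x = y" if "f x = f y" "x \<in> B" "y \<in> B" for x y
    using inj that by (auto dest: inj_onD)
  have w_scale: "\<omega> (scale c x) = c * \<omega> x" if "x \<in> A" for c x
    using weight_morphism that by (auto simp: algebra_morphism_def linear_on_def)
  have w_add: "\<omega> (x + y) = \<omega> x + \<omega> y" and w_mult: "\<omega> (mult x y) = \<omega> x * \<omega> y"
    if "x \<in> A" "y \<in> A" for x y
    using weight_morphism that by (auto simp: algebra_morphism_def linear_on_def)
  have na: "nonassoc_algebra t B n"
    by (unfold_locales; (intro sub closed eqI)?;
        simp add: hom cl f_add f_scale fA mult_add_left mult_add_right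
          mult_scale_left mult_scale_right)
  have field: "nonassoc_algebra ((*) :: 'a \<Rightarrow> 'a \<Rightarrow> 'a) UNIV (*)"
    using comm_nonassoc_algebra_field by (rule comm_nonassoc_algebra.axioms(1))
  interpret B: nonassoc_algebra t B n by (rule na)
  show ?thesis
  proof unfold_locales
    fix x y assume "x \<in> B" "y \<in> B"
    then show "n x y = n y x"
      by (intro eqI) (simp_all add: hom cl fA mult_comm)
  next
    show "algebra_morphism t B n (*) UNIV (*) v"
      using na field
      by (auto simp: algebra_morphism_def linear_on_def weight cl f_add f_scale fA hom
          w_add w_scale w_mult)
  next
    fix x assume "x \<in> B"
    then show "n (n x x) (n x x) = t ((v x)\<^sup>2) (n x x)"
      by (intro eqI) (simp_all add: hom cl fA f_scale weight bernstein)
  qed (rule nonzero)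
qed

section \<open>The kernel of the weight\<close>

context bernstein_algebra
begin

abbreviation K where "K \<equiv> weight_kernel A \<omega>"

lemma weight_add: "x \<in> A \<Longrightarrow> y \<in> A \<Longrightarrow> \<omega> (x + y) = \<omega> x + \<omega> y"
  and weight_scale: "x \<in> A \<Longrightarrow> \<omega> (scale c x) = c * \<omega> x"
  and weight_mult: "x \<in> A \<Longrightarrow> y \<in> A \<Longrightarrow> \<omega> (mult x y) = \<omega> x * \<omega> y"
  using weight_morphism by (auto simp: algebra_morphism_def linear_on_def)

lemmas carrier_closed = mult_closed subspace_add[OF carrier_subspace]
  subspace_scale[OF carrier_subspace] subspace_0[OF carrier_subspace]
  subspace_diff[OF carrier_subspace]

lemma weight_kernelD: "x \<in> K \<Longrightarrow> x \<in> A" "x \<in> K \<Longrightarrow> \<omega> x = 0"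
  by (auto simp: weight_kernel_def)

lemma subspace_weight_kernel: "subspace K"
proof -
  have "\<omega> 0 = 0" using weight_scale[of 0 0] carrier_closed(4) by simp
  then show ?thesis
    by (auto simp: subspace_def weight_kernel_def carrier_closed weight_add weight_scale)
qed

lemma four_algebra_weight_kernel: "four_algebra scale K mult"
proof unfold_locales
  fix x assume "x \<in> K"
  then show "mult (mult x x) (mult x x) = 0"
    using bernstein[of x] by (simp add: weight_kernelD)
qed (use subspace_weight_kernel in \<open>auto simp: weight_kernel_def carrier_closed weight_mult mult_add_left
    mult_add_right mult_scale_left mult_scale_right mult_comm\<close>)

text \<open>Any vector of nonzero weight can be rescaled to weight 1, and then its square is idempotent.\<close>

lemma ex_idempotent_weight_1: "\<exists>e\<in>A. mult e e = e \<and> \<omega> e = 1"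
proof -
  obtain x where x: "x \<in> A" "\<omega> x \<noteq> 0" using weight_nonzero by auto
  define a where "a = scale (1 / \<omega> x) x"
  have a: "a \<in> A" "\<omega> a = 1" using x by (simp_all add: a_def carrier_closed weight_scale)
  show ?thesis
    using a bernstein[OF a(1)] by (intro bexI[of _ "mult a a"]) (simp_all add: weight_mult mult_closed)
qed

end

section \<open>The operator of an idempotent\<close>

locale bernstein_algebra_idempotent = bernstein_algebra +
  fixes e
  assumes e_in: "e \<in> A" and e_idem: "mult e e = e" and weight_e: "\<omega> e = 1"
    and two_neq_0: "(2::'a) \<noteq> 0"
begin

text \<open>Without the factor 2, the map would be half of an idempotent on the kernel.\<close>

definition Om where "Om x = scale 2 (mult e x)"

text \<open>This is the isomorphism \<open>\<psi>\<close>.\<close>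

definition recompose where "recompose = (\<lambda>(x, \<alpha>). x + scale \<alpha> e)"

lemma Om_closed: "x \<in> A \<Longrightarrow> Om x \<in> A"
  by (simp add: Om_def carrier_closed e_in)

lemma Om_add: "x \<in> A \<Longrightarrow> y \<in> A \<Longrightarrow> Om (x + y) = Om x + Om y"
  by (simp add: Om_def mult_add_right e_in scale_right_distrib)

lemma Om_scale: "x \<in> A \<Longrightarrow> Om (scale c x) = scale c (Om x)"
  by (simp add: Om_def mult_scale_right e_in mult.commute)

lemma Om_weight_kernel: "x \<in> K \<Longrightarrow> Om x \<in> K"
  by (auto simp: weight_kernel_def Om_closed)
    (simp add: Om_def weight_scale weight_mult carrier_closed e_in)

lemma linear_on_Om: "linear_on scale K scale K Om"
  by (auto simp: linear_on_def Om_weight_kernel Om_add Om_scale weight_kernelD)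

lemma mult_e: "x \<in> A \<Longrightarrow> mult e x = scale (1 / 2) (Om x)" "x \<in> A \<Longrightarrow> mult x e = scale (1 / 2) (Om x)"
  using two_neq_0 by (simp_all add: Om_def mult_comm[OF _ e_in])

text \<open>
  The right-hand side is the image under \<open>recompose\<close> of the semidirect product of \<open>(x, \<alpha>)\<close> and
  \<open>(y, \<beta>)\<close>.
\<close>

lemma mult_add_e:
  assumes "x \<in> A" "y \<in> A"
  shows "mult (x + scale \<alpha> e) (y + scale \<beta> e) =
    mult x y + scale (1 / 2 * \<alpha>) (Om y) + scale (1 / 2 * \<beta>) (Om x) + scale (\<alpha> * \<beta>) e"
proof -
  have "mult (x + scale \<alpha> e) (y + scale \<beta> e) =
     mult x y + scale \<beta> (mult x e) + scale \<alpha> (mult e y) + scale (\<alpha> * \<beta>) (mult e e)"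
    using assms by (simp add: mult_add_left mult_add_right mult_scale_left mult_scale_right
        carrier_closed e_in scale_right_distrib mult.commute add_ac)
  then show ?thesis using assms by (simp add: e_idem mult_e add_ac)
qed

lemma square_add_e:
  assumes "x \<in> A"
  shows "mult (x + scale \<alpha> e) (x + scale \<alpha> e) = mult x x + scale \<alpha> (Om x) + scale (\<alpha>\<^sup>2) e"
proof -
  have "1 / 2 * \<alpha> + 1 / 2 * \<alpha> = \<alpha>"
    using two_neq_0 by (simp flip: distrib_right mult_2)
  then have "scale (1 / 2 * \<alpha>) (Om x) + scale (1 / 2 * \<alpha>) (Om x) = scale \<alpha> (Om x)"
    by (simp only: scale_left_distrib[symmetric])
  then show ?thesis
    using mult_add_e[OF assms assms, of \<alpha> \<alpha>] by (simp add: add.assoc power2_eq_square)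
qed

text \<open>
  The three summands are, up to a factor 2 in the first one, the defects of the three Bernstein
  operator axioms. Squaring \<open>x + \<alpha> e\<close> twice is two applications of the same square formula,
  the second one to \<open>x\<^sup>2 + \<alpha> \<Omega> x\<close> in place of \<open>x\<close>.
\<close>

lemma bernstein_identity_expansion:
  assumes "x \<in> K"
  shows "scale \<alpha> (scale 2 (mult (mult x x) (Om x)))
    + scale (\<alpha>\<^sup>2) (mult (Om x) (Om x) + Om (mult x x) - mult x x)
    + scale (\<alpha> ^ 3) (Om (Om x) - Om x) = 0"
proof -
  have x: "x \<in> A" "\<omega> x = 0" using assms by (simp_all add: weight_kernelD)
  define u where "u = mult x x"
  define w where "w = Om x"
  define y where "y = x + scale \<alpha> e"
  have uw: "u \<in> A" "w \<in> A" using x by (simp_all add: u_def w_def carrier_closed Om_closed)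
  have y: "y \<in> A" "\<omega> y = \<alpha>"
    using x by (simp_all add: y_def carrier_closed e_in weight_add weight_scale weight_e)
  have yy: "mult y y = (u + scale \<alpha> w) + scale (\<alpha>\<^sup>2) e"
    unfolding y_def u_def w_def by (rule square_add_e[OF x(1)])
  have "mult u u = 0" using bernstein[OF x(1)] x by (simp add: u_def)
  then have sq: "mult (u + scale \<alpha> w) (u + scale \<alpha> w)
      = scale \<alpha> (scale 2 (mult u w)) + scale (\<alpha>\<^sup>2) (mult w w)"
    using uw mult_comm[OF uw] scale_left_distrib[of 1 1 "mult u w"]
    by (simp add: mult_add_left mult_add_right mult_scale_left mult_scale_right carrier_closed
        scale_right_distrib power2_eq_square add_ac del: scale_scale)
      (simp add: algebra_simps)
  have "mult (mult y y) (mult y y) = mult (u + scale \<alpha> w) (u + scale \<alpha> w)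
      + scale (\<alpha>\<^sup>2) (Om (u + scale \<alpha> w)) + scale ((\<alpha>\<^sup>2)\<^sup>2) e"
    unfolding yy using uw by (intro square_add_e) (simp add: carrier_closed)
  also have "Om (u + scale \<alpha> w) = Om u + scale \<alpha> (Om w)"
    using uw by (simp add: Om_add Om_scale carrier_closed)
  finally have "scale (\<alpha>\<^sup>2) (u + scale \<alpha> w + scale (\<alpha>\<^sup>2) e)
      = scale \<alpha> (scale 2 (mult u w)) + scale (\<alpha>\<^sup>2) (mult w w)
        + scale (\<alpha>\<^sup>2) (Om u + scale \<alpha> (Om w)) + scale ((\<alpha>\<^sup>2)\<^sup>2) e"
    using bernstein[OF y(1)] unfolding y(2) sq yy by simp
  then show ?thesis
    unfolding u_def[symmetric] w_def[symmetric]
    by (simp add: scale_right_distrib scale_right_diff_distrib algebra_simps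
        power2_eq_square power3_eq_cube)
qed

lemma bernstein_operator_Om:
  assumes "infinite (UNIV :: 'a set)"
  shows "bernstein_operator scale K mult Om"
proof -
  interpret N: four_algebra scale K mult by (rule four_algebra_weight_kernel)
  note coeffs = vector_cubic_vanishes[OF assms two_neq_0 bernstein_identity_expansion]
  show ?thesis
  proof unfold_locales
    fix x assume x: "x \<in> K"
    show "Om (Om x) = Om x" using coeffs(3)[OF x] by simp
    show "mult (mult x x) (Om x) = 0" using coeffs(1)[OF x] two_neq_0 by simp
    show "mult (Om x) (Om x) + Om (mult x x) = mult x x" using coeffs(2)[OF x] by simp
  qed (rule linear_on_Om)
qed

lemma normal_bernstein_operator_Om:
  assumes inf: "infinite (UNIV :: 'a set)"
    and normal: "normal_bernstein_algebra scale A mult \<omega>"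
  shows "normal_bernstein_operator scale K mult Om"
proof -
  interpret N: bernstein_operator scale K mult Om by (rule bernstein_operator_Om[OF inf])
  note nb = normal_bernstein_algebra.normal_bernstein[OF normal]
  show ?thesis
  proof unfold_locales
    fix x assume x: "x \<in> K"
    then show "Om (mult x x) = 0"
      using nb[of x e] two_neq_0 by (simp add: mult_e e_in weight_kernelD carrier_closed)
    fix y assume "y \<in> K"
    \<comment> \<open>At \<open>x + e\<close>, of weight 1, the identity lets the square be replaced by \<open>x + e\<close> itself.\<close>
    with x have A: "x \<in> A" "y \<in> A" "\<omega> x = 0" by (simp_all add: weight_kernelD)
    have "mult (mult x x + Om x + e) y = mult (x + e) y"
      using nb[of "x + e" y] square_add_e[of x 1] A
      by (simp add: carrier_closed e_in weight_add weight_e)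
    then show "mult (Om x) y = mult x y"
      using nb[of x y] A by (simp add: mult_add_left carrier_closed e_in Om_closed)
  qed (use linear_on_Om N.operator_idem in auto)
qed

section \<open>Decomposition as a semidirect product\<close>

lemma bij_betw_recompose: "bij_betw recompose (K \<times> UNIV) A"
proof -
  have w: "\<omega> (x - scale (\<omega> x) e) = 0" if "x \<in> A" for x
    using that weight_add[of "x - scale (\<omega> x) e" "scale (\<omega> x) e"]
    by (simp add: carrier_closed e_in weight_scale weight_e)
  show ?thesis
    by (rule bij_betw_byWitness[where f' = "\<lambda>x. (x - scale (\<omega> x) e, \<omega> x)"])
      (auto simp: recompose_def weight_kernel_def weight_add weight_scale weight_e
        carrier_closed e_in w)
qed

lemma bernstein_isomorphism_recompose:
  "bernstein_isomorphism (module_prod.scale scale (*)) (K \<times> UNIV) (semidirect_mult scale mult Om) snd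
     scale A mult \<omega> recompose"
proof -
  interpret P: vector_space_prod scale "(*) :: 'a \<Rightarrow> 'a \<Rightarrow> 'a"
    using comm_nonassoc_algebra_field[where 'k = 'a] vector_space_axioms
    by (simp add: vector_space_prod_def vector_space_pair_def comm_nonassoc_algebra_def nonassoc_algebra_def)
  have vs: "vector_space P.scale" by unfold_locales
  note K = weight_kernelD
  have sub: "P.p.subspace (K \<times> UNIV)"
    using subspace_weight_kernel by (auto simp: P.p.subspace_def subspace_def P.scale_def zero_prod_def)
  have lin: "linear_on P.scale (K \<times> UNIV) scale A recompose"
    by (auto simp: linear_on_def recompose_def P.scale_def K carrier_closed e_in
        scale_left_distrib scale_right_distrib add_ac)
  have closed: "semidirect_mult scale mult Om p q \<in> K \<times> UNIV" if "p \<in> K \<times> UNIV" "q \<in> K \<times> UNIV" for p q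
    using that Om_weight_kernel
    by (auto simp: semidirect_mult_def weight_kernel_def weight_add weight_scale weight_mult
        carrier_closed Om_closed)
  have hom: "recompose (semidirect_mult scale mult Om p q) = mult (recompose p) (recompose q)"
    if "p \<in> K \<times> UNIV" "q \<in> K \<times> UNIV" for p q
    using that by (auto simp: semidirect_mult_def recompose_def mult_add_e K)
  have weight: "snd p = \<omega> (recompose p)" if "p \<in> K \<times> UNIV" for p
    using that by (auto simp: recompose_def K weight_add weight_scale weight_e carrier_closed e_in)
  have "(0, 1) \<in> K \<times> (UNIV :: 'a set)" using subspace_0[OF subspace_weight_kernel] by simp
  then have "\<exists>p\<in>K \<times> (UNIV :: 'a set). snd p \<noteq> 0"
    by (intro bexI[of _ "(0, 1)"]) simp_all
  from bernstein_algebra_pullback[OF vs sub lin bij_betw_imp_inj_on[OF bij_betw_recompose]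
      closed hom weight this]
  have prod: "bernstein_algebra P.scale (K \<times> UNIV) (semidirect_mult scale mult Om) snd" .
  moreover have "nonassoc_algebra P.scale (K \<times> UNIV) (semidirect_mult scale mult Om)"
    using prod by (simp add: bernstein_algebra_def baric_algebra_def comm_nonassoc_algebra_def)
  ultimately show ?thesis
    unfolding bernstein_isomorphism_def bernstein_morphism_def algebra_morphism_def
    by (intro conjI ballI bij_betw_recompose lin hom weight[symmetric]
        bernstein_algebra_axioms nonassoc_algebra_axioms)
qed

lemma recompose_weight_kernel: "recompose (x, 0) = x"
  by (simp add: recompose_def)

end

theorem theorem2p6:
  fixes s :: "'k::field \<Rightarrow> 'a::ab_group_add \<Rightarrow> 'a"
    and A :: "'a set" and mult :: "'a \<Rightarrow> 'a \<Rightarrow> 'a" and \<omega> :: "'a \<Rightarrow> 'k"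
    and N :: "'a set"
  assumes "infinite (UNIV :: 'k set)" and "CHAR('k) \<noteq> 2"
    and "N = weight_kernel A \<omega>"
  shows "(bernstein_algebra s A mult \<omega> \<longrightarrow>
           (\<exists>(dot :: 'a \<Rightarrow> 'a \<Rightarrow> 'a) (\<Omega> :: 'a \<Rightarrow> 'a) (\<psi> :: 'a \<times> 'k \<Rightarrow> 'a).
              four_algebra s N dot \<and>
              bernstein_operator s N dot \<Omega> \<and>
              bernstein_isomorphism
                (module_prod.scale s (*)) (N \<times> UNIV) (semidirect_mult s dot \<Omega>) snd
                s A mult \<omega> \<psi> \<and>
              (\<forall>x\<in>N. \<psi> (x, 0) = x))) \<and>
         (normal_bernstein_algebra s A mult \<omega> \<longrightarrow>
           (\<exists>(dot :: 'a \<Rightarrow> 'a \<Rightarrow> 'a) (\<Omega> :: 'a \<Rightarrow> 'a) (\<psi> :: 'a \<times> 'k \<Rightarrow> 'a).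
              four_algebra s N dot \<and>
              normal_bernstein_operator s N dot \<Omega> \<and>
              bernstein_isomorphism
                (module_prod.scale s (*)) (N \<times> UNIV) (semidirect_mult s dot \<Omega>) snd
                s A mult \<omega> \<psi> \<and>
              (\<forall>x\<in>N. \<psi> (x, 0) = x)))"
proof -
  have idem: "\<exists>e. bernstein_algebra_idempotent s A mult \<omega> e" if "bernstein_algebra s A mult \<omega>"
    using bernstein_algebra.ex_idempotent_weight_1[OF that] that
      two_neq_zero_if_CHAR_neq_2[OF assms(2)]
    by (auto simp: bernstein_algebra_idempotent_def bernstein_algebra_idempotent_axioms_def)
  show ?thesis
  proof (intro conjI impI)
    assume "bernstein_algebra s A mult \<omega>"
    then obtain e where "bernstein_algebra_idempotent s A mult \<omega> e" using idem by blast
    then interpret bernstein_algebra_idempotent s A mult \<omega> e .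
    show "\<exists>dot \<Omega> \<psi>. four_algebra s N dot \<and> bernstein_operator s N dot \<Omega> \<and>
        bernstein_isomorphism (module_prod.scale s (*)) (N \<times> UNIV) (semidirect_mult s dot \<Omega>) snd
          s A mult \<omega> \<psi> \<and> (\<forall>x\<in>N. \<psi> (x, 0) = x)"
      unfolding assms(3)
      using four_algebra_weight_kernel bernstein_operator_Om[OF assms(1)]
        bernstein_isomorphism_recompose recompose_weight_kernel
      by (intro exI[of _ mult] exI[of _ Om] exI[of _ recompose] conjI ballI)
  next
    assume normal: "normal_bernstein_algebra s A mult \<omega>"
    then interpret normal_bernstein_algebra s A mult \<omega> .
    obtain e where "bernstein_algebra_idempotent s A mult \<omega> e"
      using idem bernstein_algebra_axioms by blast
    then interpret bernstein_algebra_idempotent s A mult \<omega> e .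
    show "\<exists>dot \<Omega> \<psi>. four_algebra s N dot \<and> normal_bernstein_operator s N dot \<Omega> \<and>
        bernstein_isomorphism (module_prod.scale s (*)) (N \<times> UNIV) (semidirect_mult s dot \<Omega>) snd
          s A mult \<omega> \<psi> \<and> (\<forall>x\<in>N. \<psi> (x, 0) = x)"
      unfolding assms(3)
      using four_algebra_weight_kernel normal_bernstein_operator_Om[OF assms(1) normal]
        bernstein_isomorphism_recompose recompose_weight_kernel
      by (intro exI[of _ mult] exI[of _ Om] exI[of _ recompose] conjI ballI)
  qed
qed

end
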